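(* Let $(\mathcal{M},d,0)$ and $(\mathcal{N},d',0)$ be pointed metric spaces and let $\alpha\colon(0,\infty)\to(0,\infty)$ be a Lipschitz map with $D(\alpha)(K(\alpha)+2)\le1$. If $T\colon\mathrm{Lip}_0(\mathcal{M})\to\mathrm{Lip}_0(\mathcal{N})$ is an algebra homomorphism with respect to $\alpha$ (real scalars), then $T$ is bounded (i.e. continuous) and preserves ordering.
   Context: All spaces are real. $\mathrm{Lip}_0(\mathcal{M})$ is the Banach space of real Lipschitz functions on $\mathcal{M}$ vanishing at the base point $0$, normed by the least Lipschitz constant, and ordered pointwise ($f\ge0$ iff $f(x)\ge0$ for all $x$). $\mathrm{Lip}(\alpha)$ is the least Lipschitz constant of $\alpha$, $D(\alpha)=\sup_{t>0}t/\alpha(t)$, $K(\alpha)=\mathrm{Lip}(\alpha)D(\alpha)$. The product $\odot_\alpha$ on $\mathrm{Lip}_0(\mathcal{M})$ is $(f\odot_\alpha g)(x)=f(x)g(x)/\alpha(d(0,x))$ for $x\neq0$ and $(f\odot_\alpha g)(0)=0$, and similarly on $\mathrm{Lip}_0(\mathcal{N})$ with the same $\alpha$; these are Banach algebras. $T$ is an algebra homomorphism with respect to $\alpha$ if it is linear and preserves $\odot_\alpha$. *)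

theory Defs
  imports "HOL-Analysis.Analysis"
begin

text \<open>
  A pointed metric space is a type of class \<^class>\<open>metric_space\<close> together with an explicitly given
  base point.  Functions on the space of Lipschitz functions are modelled by functions on all of
  \<open>'a \<Rightarrow> real\<close>, of which only the values on the carrier \<open>Lip0 a\<close> are relevant.
\<close>

definition Lip_const :: "'a::metric_space set \<Rightarrow> ('a \<Rightarrow> real) \<Rightarrow> real" where
  "Lip_const S f = Inf {L. L-lipschitz_on S f}"

definition Lip0 :: "'a::metric_space \<Rightarrow> ('a \<Rightarrow> real) set" where
  "Lip0 a = {f. f a = 0 \<and> (\<exists>L. L-lipschitz_on UNIV f)}"

abbreviation Lip0_norm :: "('a::metric_space \<Rightarrow> real) \<Rightarrow> real" where
  "Lip0_norm f \<equiv> Lip_const UNIV f"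

text \<open>
  The supremum is taken in the extended reals, since it is infinite for some Lipschitz \<open>\<alpha>\<close>
  (for example for constant \<open>\<alpha>\<close>).
\<close>

definition D_const :: "(real \<Rightarrow> real) \<Rightarrow> ereal" where
  "D_const \<alpha> = (SUP t\<in>{0<..}. ereal (t / \<alpha> t))"

definition K_const :: "(real \<Rightarrow> real) \<Rightarrow> ereal" where
  "K_const \<alpha> = ereal (Lip_const {0<..} \<alpha>) * D_const \<alpha>"

definition alpha_prod ::
    "(real \<Rightarrow> real) \<Rightarrow> 'a::metric_space \<Rightarrow> ('a \<Rightarrow> real) \<Rightarrow> ('a \<Rightarrow> real) \<Rightarrow> 'a \<Rightarrow> real" where
  "alpha_prod \<alpha> a f g = (\<lambda>x. if x = a then 0 else f x * g x / \<alpha> (dist a x))"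

definition Lip0_linear ::
    "'a::metric_space \<Rightarrow> 'b::metric_space \<Rightarrow> (('a \<Rightarrow> real) \<Rightarrow> ('b \<Rightarrow> real)) \<Rightarrow> bool" where
  "Lip0_linear a b T \<longleftrightarrow>
     T \<in> Lip0 a \<rightarrow> Lip0 b \<and>
     (\<forall>f\<in>Lip0 a. \<forall>g\<in>Lip0 a. T (\<lambda>x. f x + g x) = (\<lambda>y. T f y + T g y)) \<and>
     (\<forall>c::real. \<forall>f\<in>Lip0 a. T (\<lambda>x. c * f x) = (\<lambda>y. c * T f y))"

definition alpha_hom ::
    "(real \<Rightarrow> real) \<Rightarrow> 'a::metric_space \<Rightarrow> 'b::metric_space \<Rightarrow>
     (('a \<Rightarrow> real) \<Rightarrow> ('b \<Rightarrow> real)) \<Rightarrow> bool" where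
  "alpha_hom \<alpha> a b T \<longleftrightarrow>
     Lip0_linear a b T \<and>
     (\<forall>f\<in>Lip0 a. \<forall>g\<in>Lip0 a. T (alpha_prod \<alpha> a f g) = alpha_prod \<alpha> b (T f) (T g))"

definition Lip0_bounded ::
    "'a::metric_space \<Rightarrow> (('a \<Rightarrow> real) \<Rightarrow> ('b::metric_space \<Rightarrow> real)) \<Rightarrow> bool" where
  "Lip0_bounded a T \<longleftrightarrow> (\<exists>C. \<forall>f\<in>Lip0 a. Lip0_norm (T f) \<le> C * Lip0_norm f)"

end

theory Submission
  imports Defs
begin

text \<open>
  Fix \<open>y \<noteq> b\<close>.  The number \<open>T f y / \<alpha> (dist b y)\<close> depends on \<open>f\<close> linearly and multiplicatively,
  so it is a character of the algebra \<open>Lip0 a\<close>.  As for every algebra of functions that is closed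
  under inversion of functions bounded away from zero, the value of a character at \<open>f\<close> is, if it is
  nonzero, in the closure of the range of \<open>x \<mapsto> f x / \<alpha> (dist a x)\<close>, the function on the complement of the
  base point that \<open>f\<close> represents in the algebra.  Indeed, if a nonzero \<open>c\<close> has positive
  distance from that range, then \<open>h = f / c\<close> has the quasi-inverse \<open>g = h / (1 - h / \<alpha>)\<close>, which is again a Lipschitz function
  (\<open>quasi_inverse_in_Lip0\<close>); it satisfies \<open>g = h + h \<odot> g\<close>, and a character with value \<open>1\<close> at \<open>h\<close>
  would turn this identity into \<open>t = 1 + t\<close>, where \<open>t\<close> is its value at \<open>g\<close>
  (\<open>character_value_not_separated\<close>).

  Both claims follow from this localisation of the character values.  If \<open>f \<ge> 0\<close>, the range lies in
  the nonnegative reals, hence so do the values of the characters, and \<open>T f \<ge> 0\<close>.  If \<open>f\<close> is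
  \<open>M\<close>-Lipschitz and \<open>t \<le> D * \<alpha> t\<close> for all \<open>t > 0\<close>, the range is bounded by \<open>D * M\<close>, hence each
  evaluation \<open>f \<mapsto> T f y\<close> is a bounded functional.  The graph of \<open>T\<close> is thus closed, and \<open>T\<close> is
  bounded because \<open>Lip0 a\<close> is complete; \<open>bounded_if_evaluations_bounded\<close> carries this out by a
  gliding hump.
\<close>

section \<open>The space of Lipschitz functions\<close>

lemma Lip_const_nonneg:
  assumes "\<exists>L. L-lipschitz_on S f"
  shows "0 \<le> Lip_const S f"
  unfolding Lip_const_def using assms
  by (intro cInf_greatest) (auto dest: lipschitz_on_nonneg)

lemma Lip_const_le:
  assumes "L-lipschitz_on S f"
  shows "Lip_const S f \<le> L"
  unfolding Lip_const_def using assms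
  by (intro cInf_lower bdd_belowI[of _ 0]) (auto dest: lipschitz_on_nonneg)

lemma Lip_const_lipschitz:
  assumes "\<exists>L. L-lipschitz_on S f"
  shows "(Lip_const S f)-lipschitz_on S f"
proof (rule lipschitz_onI)
  fix x y assume xy: "x \<in> S" "y \<in> S"
  show "dist (f x) (f y) \<le> Lip_const S f * dist x y"
  proof (cases "x = y")
    case False
    have "dist (f x) (f y) / dist x y \<le> Lip_const S f"
      unfolding Lip_const_def using assms xy False
      by (intro cInf_greatest) (auto simp: divide_le_eq dest: lipschitz_onD)
    with False show ?thesis by (simp add: divide_le_eq)
  qed simp
qed (rule Lip_const_nonneg[OF assms])

lemma Lip0_norm_lipschitz: "f \<in> Lip0 a \<Longrightarrow> (Lip0_norm f)-lipschitz_on UNIV f"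
  by (rule Lip_const_lipschitz) (simp add: Lip0_def)

lemma Lip0_I: "f a = 0 \<Longrightarrow> L-lipschitz_on UNIV f \<Longrightarrow> f \<in> Lip0 a"
  by (auto simp: Lip0_def)

lemma Lip0_base: "f \<in> Lip0 a \<Longrightarrow> f a = 0"
  by (simp add: Lip0_def)

lemma Lip0_lipschitzE:
  assumes "f \<in> Lip0 a"
  obtains L where "L-lipschitz_on UNIV f"
  using assms by (auto simp: Lip0_def)

lemma Lip0_add:
  assumes "f \<in> Lip0 a" "g \<in> Lip0 a"
  shows "(\<lambda>x. f x + g x) \<in> Lip0 a"
  using assms by (auto simp: Lip0_def intro: lipschitz_on_add)

lemma Lip0_cmult:
  assumes "f \<in> Lip0 a"
  shows "(\<lambda>x. c * f x) \<in> Lip0 a"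
  using assms by (auto simp: Lip0_def intro: lipschitz_on_cmult_real)

lemma Lip0_diff:
  assumes "f \<in> Lip0 a" "g \<in> Lip0 a"
  shows "(\<lambda>x. f x - g x) \<in> Lip0 a"
  using assms by (auto simp: Lip0_def intro: lipschitz_on_diff)

lemma Lip0_abs_le:
  assumes "f a = 0" "L-lipschitz_on UNIV f"
  shows "\<bar>f x\<bar> \<le> L * dist a x"
  using lipschitz_onD[OF assms(2), of a x] assms(1) by (simp add: dist_real_def)

lemma Lip0_linear_add:
  "Lip0_linear a b T \<Longrightarrow> f \<in> Lip0 a \<Longrightarrow> g \<in> Lip0 a \<Longrightarrow> T (\<lambda>x. f x + g x) y = T f y + T g y"
  by (simp add: Lip0_linear_def)

lemma Lip0_linear_cmult:
  "Lip0_linear a b T \<Longrightarrow> f \<in> Lip0 a \<Longrightarrow> T (\<lambda>x. c * f x) y = c * T f y"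
  by (simp add: Lip0_linear_def)

lemma Lip0_linear_in: "Lip0_linear a b T \<Longrightarrow> f \<in> Lip0 a \<Longrightarrow> T f \<in> Lip0 b"
  by (auto simp: Lip0_linear_def)

lemma Lip0_linear_diff:
  assumes "Lip0_linear a b T" "f \<in> Lip0 a" "g \<in> Lip0 a"
  shows "T (\<lambda>x. f x - g x) y = T f y - T g y"
  using Lip0_linear_add[OF assms(1,2) Lip0_cmult[OF assms(3), of "-1"]]
    Lip0_linear_cmult[OF assms(1,3), of "-1"] by simp

section \<open>Linear maps with bounded evaluations\<close>

text \<open>
  Completeness of the space, in the form in which the gliding hump needs it: the
  condition on the increments makes the closed balls around \<open>s n\<close> of radius \<open>r n\<close> nested, even if
  the radii do not tend to zero, and the pointwise limit of the centres lies in all of them.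
\<close>

lemma nested_balls_common_point:
  fixes s :: "nat \<Rightarrow> 'a::metric_space \<Rightarrow> real"
  assumes s: "\<And>n. s n \<in> Lip0 a" and r: "\<And>n. 0 \<le> r n"
    and step: "\<And>n. (r n - r (Suc n))-lipschitz_on UNIV (\<lambda>x. s (Suc n) x - s n x)"
  obtains f where "f \<in> Lip0 a" "\<And>n. (r n)-lipschitz_on UNIV (\<lambda>x. f x - s n x)"
proof -
  have tele: "(r n - r m)-lipschitz_on UNIV (\<lambda>x. s m x - s n x)" if "n \<le> m" for n m
    using that
  proof (induction m rule: dec_induct)
    case base
    show ?case by (simp add: lipschitz_on_def)
  next
    case (step m)
    show ?case using lipschitz_on_add[OF step.IH assms(3)[of m]] by simp
  qed
  have "decseq r"
    using lipschitz_on_nonneg[OF step] by (intro decseq_SucI) simp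
  then obtain l where l: "r \<longlonglongrightarrow> l"
    using decseq_convergent[of r 0] r by blast
  have "convergent (\<lambda>n. s n x)" for x
  proof -
    have "Cauchy (\<lambda>n. r n * dist a x)"
      by (rule LIMSEQ_imp_Cauchy, rule tendsto_mult[OF l tendsto_const])
    moreover have "dist (s m x) (s n x) \<le> dist (r m * dist a x) (r n * dist a x)"
      if "n \<le> m" for m n
    proof -
      have "\<bar>s m x - s n x\<bar> \<le> (r n - r m) * dist a x"
        using Lip0_abs_le[OF _ tele[OF that], of a x] s by (simp add: Lip0_base)
      then show ?thesis
        by (simp add: dist_real_def algebra_simps)
    qed
    then have "dist (s m x) (s n x) \<le> dist (r m * dist a x) (r n * dist a x)" for m n
      by (metis dist_commute nle_le)
    ultimately have "Cauchy (\<lambda>n. s n x)"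
      unfolding Cauchy_def by (meson le_less_trans)
    then show ?thesis by (simp add: Cauchy_convergent_iff)
  qed
  then obtain f where f: "\<And>x. (\<lambda>n. s n x) \<longlonglongrightarrow> f x"
    unfolding convergent_def by metis
  have lip: "(r n)-lipschitz_on UNIV (\<lambda>x. f x - s n x)" for n
  proof (rule lipschitz_onI)
    fix x y
    have "(\<lambda>m. dist (s m x - s n x) (s m y - s n y)) \<longlonglongrightarrow> dist (f x - s n x) (f y - s n y)"
      by (intro tendsto_dist tendsto_diff f tendsto_const)
    moreover have "dist (s m x - s n x) (s m y - s n y) \<le> r n * dist x y" if "n \<le> m" for m
      using lipschitz_onD[OF tele[OF that], of x y] mult_right_mono[of "r n - r m" "r n" "dist x y"]
        r[of m] by simp
    ultimately show "dist (f x - s n x) (f y - s n y) \<le> r n * dist x y"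
      by (intro LIMSEQ_le_const2) auto
  qed (rule r)
  have "(\<lambda>n. s n a) \<longlonglongrightarrow> 0" using s by (simp add: Lip0_base)
  then have "f a = 0" using LIMSEQ_unique f by blast
  then have "(\<lambda>x. f x - s 0 x) \<in> Lip0 a"
    using lip[of 0] s[of 0] by (intro Lip0_I) (auto simp: Lip0_base)
  from Lip0_add[OF this s[of 0]] have "f \<in> Lip0 a" by simp
  with lip show thesis by (rule that[rotated])
qed

text \<open>
  This is the closed graph theorem for the case at hand.  If \<open>T\<close> were unbounded, one could choose
  successively points \<open>p n \<noteq> q n\<close> and small corrections \<open>s (Suc n) - s n\<close> such that the difference
  quotient of \<open>T (s n)\<close> at \<open>p n\<close>, \<open>q n\<close> is at least \<open>n\<close>.  Once the points are chosen, this quotient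
  is a bounded functional, so all later corrections can be kept so small that together they change
  it by at most \<open>1\<close>.  Then the image of the limit is not a Lipschitz function.
\<close>

lemma bounded_if_evaluations_bounded:
  fixes a :: "'a::metric_space" and b :: "'b::metric_space"
  assumes T: "Lip0_linear a b T"
    and eval: "\<And>y. \<exists>A. \<forall>f\<in>Lip0 a. \<forall>L. L-lipschitz_on UNIV f \<longrightarrow> \<bar>T f y\<bar> \<le> A * L"
  shows "Lip0_bounded a T"
proof -
  from eval obtain A where
    A: "\<And>y f L. f \<in> Lip0 a \<Longrightarrow> L-lipschitz_on UNIV f \<Longrightarrow> \<bar>T f y\<bar> \<le> A y * L"
    by metis
  have A_nonneg: "0 \<le> A y" for y
  proof -
    have "(\<lambda>x. 0) \<in> Lip0 a" by (rule Lip0_I[where L = 0]) (auto simp: lipschitz_on_def)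
    from A[OF this, of 1 y] show ?thesis by (simp add: lipschitz_on_def)
  qed
  have unit_ball: "\<exists>C. \<forall>f\<in>Lip0 a. 1-lipschitz_on UNIV f \<longrightarrow>
                       (\<forall>p q. \<bar>T f p - T f q\<bar> \<le> C * dist p q)"
  proof (rule ccontr)
    assume "\<not> ?thesis"
    then have unbounded: "\<exists>f p q. f \<in> Lip0 a \<and> 1-lipschitz_on UNIV f \<and>
        C * dist p q < \<bar>T f p - T f q\<bar>" for C
      by (meson not_le)
    \<comment> \<open>The last conjunct is the smallness of the later corrections: they add up to a function with
        Lipschitz constant at most \<open>r\<close>.\<close>
    define P where "P = (\<lambda>(n::nat) (s, r, p, q). s \<in> Lip0 a \<and> 0 < r \<and>
        real n * dist p q \<le> \<bar>T s p - T s q\<bar> \<and> p \<noteq> q \<and> r * (A p + A q) \<le> dist p q)"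
    define Q where "Q = (\<lambda>(n::nat) (s, r, p::'b, q::'b) (s', r', p'::'b, q'::'b).
        (r - r')-lipschitz_on UNIV (\<lambda>x::'a. s' x - s x :: real))"
    have step: "\<exists>s' r' p q. P n (s', r', p, q) \<and> (r - r')-lipschitz_on UNIV (\<lambda>x. s' x - s x)"
      if s: "s \<in> Lip0 a" and r: "0 < r" for s r n
    proof -
      obtain f p q where f: "f \<in> Lip0 a" "1-lipschitz_on UNIV f"
        and big: "2 * real n / r * dist p q < \<bar>T f p - T f q\<bar>"
        using unbounded by blast
      have pq: "p \<noteq> q" using big by auto
      have big': "real n * dist p q < r / 2 * \<bar>T f p - T f q\<bar>"
        using big r by (simp add: field_simps)
      have T_corr: "T (\<lambda>x. s x + c * f x) y = T s y + c * T f y" for c y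
        using Lip0_linear_add[OF T s Lip0_cmult[OF f(1)]] Lip0_linear_cmult[OF T f(1)] by simp
      \<comment> \<open>Since \<open>\<bar>u + v\<bar> + \<bar>u - v\<bar> \<ge> 2 * \<bar>v\<bar>\<close>, one of the two signs does not decrease the quotient
          below the contribution of the correction.\<close>
      define v where "v = r / 2 * (T f p - T f q)"
      have "r / 2 * \<bar>T f p - T f q\<bar> = \<bar>v\<bar>"
        using r by (simp add: v_def abs_mult)
      then have "real n * dist p q \<le> \<bar>(T s p - T s q) + v\<bar> \<or>
                 real n * dist p q \<le> \<bar>(T s p - T s q) - v\<bar>"
        using big' by linarith
      then obtain c where c: "\<bar>c\<bar> = r / 2"
        and hump: "real n * dist p q \<le> \<bar>(T s p - T s q) + c * (T f p - T f q)\<bar>"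
      proof
        assume "real n * dist p q \<le> \<bar>(T s p - T s q) + v\<bar>"
        then show thesis using r by (intro that[of "r / 2"]) (auto simp: v_def)
      next
        assume "real n * dist p q \<le> \<bar>(T s p - T s q) - v\<bar>"
        then show thesis using r by (intro that[of "- (r / 2)"]) (auto simp: v_def)
      qed
      define r' where "r' = min (r / 2) (dist p q / (A p + A q + 1))"
      have Apos: "0 < A p + A q + 1" using A_nonneg[of p] A_nonneg[of q] by simp
      have r': "0 < r'" "r' \<le> r / 2"
        unfolding r'_def using r pq Apos by (simp, intro min.cobounded1)
      have "r' * (A p + A q) \<le> r' * (A p + A q + 1)" using r' by simp
      also have "\<dots> \<le> dist p q / (A p + A q + 1) * (A p + A q + 1)"
        using Apos by (intro mult_right_mono) (auto simp: r'_def)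
      also have "\<dots> = dist p q" using Apos by simp
      finally have "P n (\<lambda>x. s x + c * f x, r', p, q)"
        using hump pq r' Lip0_add[OF s Lip0_cmult[OF f(1), of c]]
        by (simp add: P_def T_corr algebra_simps)
      moreover have "(r - r')-lipschitz_on UNIV (\<lambda>x. s x + c * f x - s x)"
        using lipschitz_on_le[OF lipschitz_on_cmult_real[OF f(2), of c]] c r' by simp
      ultimately show ?thesis by blast
    qed
    have "\<exists>z. \<forall>n. P n (z n) \<and> Q n (z n) (z (Suc n))"
    proof (rule dependent_nat_choice)
      have "(\<lambda>x. 0) \<in> Lip0 a" by (rule Lip0_I[where L = 0]) (auto simp: lipschitz_on_def)
      from step[OF this, of 1 0] show "\<exists>z. P 0 z" by auto
    next
      fix z n assume "P n z"
      then obtain s r p q where z: "z = (s, r, p, q)" "s \<in> Lip0 a" "0 < r"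
        by (cases z) (auto simp: P_def)
      from step[OF z(2,3), of "Suc n"] show "\<exists>z'. P (Suc n) z' \<and> Q n z z'"
        unfolding z(1) Q_def by fastforce
    qed
    then obtain z where z: "\<And>n. P n (z n)" "\<And>n. Q n (z n) (z (Suc n))" by blast
    define s r p q where defs: "s = (\<lambda>n. fst (z n))" "r = (\<lambda>n. fst (snd (z n)))"
      "p = (\<lambda>n. fst (snd (snd (z n))))" "q = (\<lambda>n. snd (snd (snd (z n))))"
    have PP: "s n \<in> Lip0 a" "0 < r n" "real n * dist (p n) (q n) \<le> \<bar>T (s n) (p n) - T (s n) (q n)\<bar>"
      "p n \<noteq> q n" "r n * (A (p n) + A (q n)) \<le> dist (p n) (q n)" for n
      using z(1)[of n] by (auto simp: P_def defs split: prod.splits)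
    have QQ: "(r n - r (Suc n))-lipschitz_on UNIV (\<lambda>x. s (Suc n) x - s n x)" for n
      using z(2)[of n] by (auto simp: Q_def defs split: prod.splits)
    obtain f where f: "f \<in> Lip0 a" "\<And>n. (r n)-lipschitz_on UNIV (\<lambda>x. f x - s n x)"
      using nested_balls_common_point[of s a r] PP(1) less_imp_le[OF PP(2)] QQ by blast
    obtain L where L: "L-lipschitz_on UNIV (T f)"
      using Lip0_lipschitzE[OF Lip0_linear_in[OF T f(1)]] .
    have "real n - 1 \<le> L" for n
    proof -
      have close: "\<bar>T f y - T (s n) y\<bar> \<le> A y * r n" for y
        using A[OF Lip0_diff[OF f(1) PP(1)] f(2)] Lip0_linear_diff[OF T f(1) PP(1)] by simp
      have "\<bar>T f (p n) - T f (q n)\<bar> \<le> L * dist (p n) (q n)"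
        using lipschitz_onD[OF L, of "p n" "q n"] by (simp add: dist_real_def)
      moreover have "A (p n) * r n + A (q n) * r n \<le> dist (p n) (q n)"
        using PP(5)[of n] by (simp add: algebra_simps)
      ultimately have "real n * dist (p n) (q n) \<le> (L + 1) * dist (p n) (q n)"
        using close[of "p n"] close[of "q n"] PP(3)[of n] by (simp add: distrib_right)
      then show ?thesis using PP(4)[of n] by simp
    qed
    then have "real n \<le> L + 1" for n by (simp add: algebra_simps)
    then show False using reals_Archimedean2[of "L + 1"] by (meson not_le)
  qed
  then obtain C where
    C: "\<And>f p q. f \<in> Lip0 a \<Longrightarrow> 1-lipschitz_on UNIV f \<Longrightarrow> \<bar>T f p - T f q\<bar> \<le> C * dist p q"
    by blast
  have "Lip0_norm (T f) \<le> max C 0 * Lip0_norm f" if f: "f \<in> Lip0 a" for f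
  proof (rule Lip_const_le, rule lipschitz_onI)
    note lip = Lip0_norm_lipschitz[OF f]
    note nonneg = lipschitz_on_nonneg[OF lip]
    show "0 \<le> max C 0 * Lip0_norm f" using nonneg by simp
    fix p q
    show "dist (T f p) (T f q) \<le> max C 0 * Lip0_norm f * dist p q"
    proof (cases "Lip0_norm f = 0")
      case True
      then have "\<bar>T f y\<bar> \<le> 0" for y using A[OF f lip, of y] by simp
      then show ?thesis using True by simp
    next
      case False
      define g where "g = (\<lambda>x. inverse (Lip0_norm f) * f x)"
      have "1-lipschitz_on UNIV g"
        using lipschitz_on_cmult_real[OF lip, of "inverse (Lip0_norm f)"] False nonneg
        by (simp add: g_def)
      then have "\<bar>T g p - T g q\<bar> \<le> C * dist p q"
        using C Lip0_cmult[OF f] by (simp add: g_def)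
      also have "\<dots> \<le> max C 0 * dist p q" by (simp add: mult_right_mono)
      also have "T g p - T g q = inverse (Lip0_norm f) * (T f p - T f q)"
        unfolding g_def Lip0_linear_cmult[OF T f] by (rule right_diff_distrib[symmetric])
      finally show ?thesis using False nonneg
        by (simp add: abs_mult dist_real_def field_simps)
    qed
  qed
  then show ?thesis unfolding Lip0_bounded_def by blast
qed

section \<open>Characters of the algebra\<close>

text \<open>
  In the difference of two values of the quasi-inverse, the terms containing \<open>h x * h y\<close> combine to
  a difference of values of \<open>1 / \<alpha>\<close>.  As \<open>\<bar>h\<bar> \<le> H * D * \<alpha>\<close>, the Lipschitz constant of \<open>\<alpha>\<close> controls
  it, although \<open>1 / \<alpha>\<close> itself need not be Lipschitz.
\<close>

lemma quasi_inverse_in_Lip0: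
  fixes a :: "'a::metric_space"
  assumes alpha_pos: "\<And>t. t > 0 \<Longrightarrow> \<alpha> t > 0"
    and alpha_lip: "L-lipschitz_on {0<..} \<alpha>"
    and D: "\<And>t. t > 0 \<Longrightarrow> t \<le> D * \<alpha> t"
    and h: "h \<in> Lip0 a" and \<delta>: "0 < \<delta>"
    and sep: "\<And>x. x \<noteq> a \<Longrightarrow> \<delta> \<le> \<bar>1 - h x / \<alpha> (dist a x)\<bar>"
  shows "(\<lambda>x. if x = a then 0 else h x / (1 - h x / \<alpha> (dist a x))) \<in> Lip0 a" (is "?g \<in> _")
proof -
  obtain H where H: "H-lipschitz_on UNIV h" using h by (rule Lip0_lipschitzE)
  note H0 = lipschitz_on_nonneg[OF H] and L0 = lipschitz_on_nonneg[OF alpha_lip]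
  define w where "w = (\<lambda>x. 1 - h x / \<alpha> (dist a x))"
  define B where "B = H + (H * D)\<^sup>2 * L"
  have B0: "0 \<le> B" using H0 L0 by (simp add: B_def)
  have at_base: "\<bar>?g x\<bar> \<le> H / \<delta> * dist a x" for x
  proof (cases "x = a")
    case False
    have "\<bar>h x\<bar> / \<bar>w x\<bar> \<le> (H * dist a x) / \<delta>"
      using Lip0_abs_le[OF Lip0_base[OF h] H] sep[OF False] \<delta> H0
      by (intro frac_le) (auto simp: w_def)
    then show ?thesis using False by (simp add: w_def)
  qed simp
  have off_base: "\<bar>?g x - ?g y\<bar> \<le> B / \<delta>\<^sup>2 * dist x y" if x: "x \<noteq> a" and y: "y \<noteq> a" for x y
  proof -
    let ?\<alpha> = "\<lambda>x. \<alpha> (dist a x)"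
    have pos: "0 < ?\<alpha> x" "0 < ?\<alpha> y" using alpha_pos x y by auto
    have small: "\<bar>h z / ?\<alpha> z\<bar> \<le> H * D" if z: "z \<noteq> a" for z
    proof -
      have "\<bar>h z\<bar> \<le> H * dist a z" by (rule Lip0_abs_le[OF Lip0_base[OF h] H])
      also have "\<dots> \<le> H * (D * ?\<alpha> z)" using z H0 by (intro mult_left_mono D) auto
      finally show ?thesis using alpha_pos[of "dist a z"] z by (simp add: divide_le_eq mult.assoc)
    qed
    have w0: "w x \<noteq> 0" "w y \<noteq> 0" using sep[OF x] sep[OF y] \<delta> by (auto simp: w_def)
    have "\<bar>?\<alpha> y - ?\<alpha> x\<bar> \<le> L * \<bar>dist a y - dist a x\<bar>"
      using lipschitz_onD[OF alpha_lip, of "dist a y" "dist a x"] x y by (simp add: dist_real_def)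
    also have "\<bar>dist a y - dist a x\<bar> \<le> dist x y"
      using dist_triangle[of a y x] dist_triangle[of a x y] by (simp add: dist_commute abs_le_iff)
    finally have alp: "\<bar>?\<alpha> y - ?\<alpha> x\<bar> \<le> L * dist x y" using L0 by (simp add: mult_left_mono)
    have num: "h x * w y - h y * w x
        = (h x - h y) + (h x / ?\<alpha> x) * (h y / ?\<alpha> y) * (?\<alpha> y - ?\<alpha> x)"
      using pos by (simp add: w_def field_simps)
    have "\<bar>h x * w y - h y * w x\<bar>
        \<le> \<bar>h x - h y\<bar> + \<bar>h x / ?\<alpha> x\<bar> * \<bar>h y / ?\<alpha> y\<bar> * \<bar>?\<alpha> y - ?\<alpha> x\<bar>"
      unfolding num by (metis abs_mult abs_triangle_ineq)
    also have "\<dots> \<le> H * dist x y + (H * D) * (H * D) * (L * dist x y)"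
    proof (intro add_mono mult_mono small x y alp)
      show "\<bar>h x - h y\<bar> \<le> H * dist x y"
        using lipschitz_onD[OF H, of x y] by (simp add: dist_real_def)
      show "0 \<le> H * D" using small[OF x] by linarith
      then show "0 \<le> H * D * (H * D)" by simp
    qed auto
    also have "\<dots> = B * dist x y" by (simp add: B_def power2_eq_square algebra_simps)
    finally have 1: "\<bar>h x * w y - h y * w x\<bar> \<le> B * dist x y" .
    have "\<delta> * \<delta> \<le> \<bar>w x\<bar> * \<bar>w y\<bar>"
      using sep[OF x] sep[OF y] \<delta> by (intro mult_mono) (auto simp: w_def)
    then have "\<bar>h x * w y - h y * w x\<bar> / (\<bar>w x\<bar> * \<bar>w y\<bar>) \<le> (B * dist x y) / (\<delta> * \<delta>)"
      using 1 \<delta> B0 by (intro frac_le) auto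
    moreover have "?g x - ?g y = (h x * w y - h y * w x) / (w x * w y)"
      using x y diff_frac_eq[OF w0, of "h x" "h y"] by (simp add: w_def)
    ultimately show ?thesis by (simp add: abs_mult power2_eq_square)
  qed
  have "(max (H / \<delta>) (B / \<delta>\<^sup>2))-lipschitz_on UNIV ?g"
  proof (rule lipschitz_onI)
    fix x y
    have "\<bar>?g x - ?g y\<bar> \<le> H / \<delta> * dist x y \<or> \<bar>?g x - ?g y\<bar> \<le> B / \<delta>\<^sup>2 * dist x y"
    proof (cases "x = a \<or> y = a")
      case True
      then show ?thesis using at_base[of x] at_base[of y] by (auto simp: dist_commute)
    next
      case False
      then show ?thesis using off_base by blast
    qed
    then show "dist (?g x) (?g y) \<le> max (H / \<delta>) (B / \<delta>\<^sup>2) * dist x y"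
      unfolding dist_real_def
      by (meson max.cobounded1 max.cobounded2 mult_right_mono order_trans zero_le_dist)
  next
    show "0 \<le> max (H / \<delta>) (B / \<delta>\<^sup>2)" using H0 \<delta> by (simp add: le_max_iff_disj)
  qed
  then show ?thesis by (intro Lip0_I) simp_all
qed

text \<open>
  Otherwise \<open>h = f / c\<close>, where the character has the value \<open>1\<close>, would have a quasi-inverse \<open>g\<close>.  The
  product \<open>h \<odot> g\<close> equals \<open>g - h\<close>, and computing the character at it by multiplicativity and by
  linearity gives \<open>t = t - 1\<close> for the value \<open>t\<close> at \<open>g\<close>.
\<close>

lemma character_value_not_separated:
  fixes a :: "'a::metric_space" and b :: "'b::metric_space"
  assumes alpha_pos: "\<And>t. t > 0 \<Longrightarrow> \<alpha> t > 0"
    and alpha_lip: "L-lipschitz_on {0<..} \<alpha>"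
    and D: "\<And>t. t > 0 \<Longrightarrow> t \<le> D * \<alpha> t"
    and T: "alpha_hom \<alpha> a b T"
    and f: "f \<in> Lip0 a" and y: "y \<noteq> b"
    and c: "c \<noteq> 0" "T f y = c * \<alpha> (dist b y)" and \<delta>: "0 < \<delta>"
  shows "\<exists>x. x \<noteq> a \<and> \<bar>1 - f x / (c * \<alpha> (dist a x))\<bar> < \<delta>"
proof (rule ccontr)
  assume "\<not> ?thesis"
  then have sep: "\<delta> \<le> \<bar>1 - f x / (c * \<alpha> (dist a x))\<bar>" if "x \<noteq> a" for x
    using that by force
  have lin: "Lip0_linear a b T" using T by (simp add: alpha_hom_def)
  define h where "h = (\<lambda>x. inverse c * f x)"
  have h: "h \<in> Lip0 a" unfolding h_def by (rule Lip0_cmult[OF f])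
  have sep_h: "\<delta> \<le> \<bar>1 - h x / \<alpha> (dist a x)\<bar>" if "x \<noteq> a" for x
    using sep[OF that] by (simp add: h_def divide_inverse mult_ac)
  define g where "g = (\<lambda>x. if x = a then 0 else h x / (1 - h x / \<alpha> (dist a x)))"
  have g: "g \<in> Lip0 a"
    unfolding g_def using alpha_pos alpha_lip D h \<delta> sep_h by (rule quasi_inverse_in_Lip0)
  have prod: "alpha_prod \<alpha> a h g = (\<lambda>x. g x - h x)"
  proof
    fix x
    show "alpha_prod \<alpha> a h g x = g x - h x"
    proof (cases "x = a")
      case False
      then have "\<alpha> (dist a x) > 0" "1 - h x / \<alpha> (dist a x) \<noteq> 0"
        using alpha_pos[of "dist a x"] sep_h[OF False] \<delta> by auto
      then show ?thesis using False by (simp add: alpha_prod_def g_def field_simps)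
    qed (simp add: alpha_prod_def g_def Lip0_base[OF h])
  qed
  have Ty: "\<alpha> (dist b y) > 0" using alpha_pos y by simp
  have Th: "T h y = \<alpha> (dist b y)"
    using Lip0_linear_cmult[OF lin f] c by (simp add: h_def)
  have "T g y - T h y = T (alpha_prod \<alpha> a h g) y"
    unfolding prod by (rule Lip0_linear_diff[OF lin g h, symmetric])
  also have "\<dots> = T h y * T g y / \<alpha> (dist b y)"
    using T h g y by (simp add: alpha_hom_def alpha_prod_def)
  also have "\<dots> = T g y" using Th Ty by simp
  finally show False using Th Ty by simp
qed

text \<open>
  The range of \<open>f / \<alpha>\<close> is contained in the interval \<open>[- D * M, D * M]\<close>, from which a larger character
  value would be separated.
\<close>

lemma alpha_hom_eval_bound:
  fixes a :: "'a::metric_space" and b :: "'b::metric_space"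
  assumes alpha_pos: "\<And>t. t > 0 \<Longrightarrow> \<alpha> t > 0"
    and alpha_lip: "L-lipschitz_on {0<..} \<alpha>"
    and D: "\<And>t. t > 0 \<Longrightarrow> t \<le> D * \<alpha> t"
    and T: "alpha_hom \<alpha> a b T"
    and f: "f \<in> Lip0 a" "M-lipschitz_on UNIV f" and y: "y \<noteq> b"
  shows "\<bar>T f y\<bar> \<le> D * \<alpha> (dist b y) * M"
proof (rule ccontr)
  assume not_le: "\<not> ?thesis"
  note M0 = lipschitz_on_nonneg[OF f(2)]
  have ay: "\<alpha> (dist b y) > 0" using alpha_pos y by simp
  have D0: "0 \<le> D" using D[of 1] alpha_pos[of 1]
    by (metis less_le_not_le linorder_le_cases mult_nonpos_nonneg order_trans zero_less_one)
  define c where "c = T f y / \<alpha> (dist b y)"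
  have Tf: "T f y = c * \<alpha> (dist b y)" using ay by (simp add: c_def)
  have c: "D * M < \<bar>c\<bar>"
    using not_le ay by (simp add: Tf abs_mult mult.commute mult.left_commute)
  have "0 \<le> D * M" using D0 M0 by simp
  with c have c0: "c \<noteq> 0" by auto
  have "0 < 1 - D * M / \<bar>c\<bar>" using c c0 by simp
  from character_value_not_separated[OF alpha_pos alpha_lip D T f(1) y c0 Tf this]
  obtain x where x: "x \<noteq> a" and near: "\<bar>1 - f x / (c * \<alpha> (dist a x))\<bar> < 1 - D * M / \<bar>c\<bar>"
    by blast
  have ax: "\<alpha> (dist a x) > 0" using alpha_pos x by simp
  have "\<bar>f x\<bar> \<le> M * dist a x" by (rule Lip0_abs_le[OF Lip0_base[OF f(1)] f(2)])
  also have "\<dots> \<le> M * (D * \<alpha> (dist a x))" using x M0 by (intro mult_left_mono D) auto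
  finally have "\<bar>f x / (c * \<alpha> (dist a x))\<bar> \<le> D * M / \<bar>c\<bar>"
    using ax c0 by (simp add: abs_mult field_simps)
  with near show False by linarith
qed

text \<open>
  For a negative \<open>c\<close> the function \<open>1 - f / (c * \<alpha>)\<close> is at least \<open>1\<close>, so \<open>c\<close> is separated from the range
  of \<open>f / \<alpha>\<close>.
\<close>

lemma alpha_hom_nonneg:
  fixes a :: "'a::metric_space" and b :: "'b::metric_space"
  assumes alpha_pos: "\<And>t. t > 0 \<Longrightarrow> \<alpha> t > 0"
    and alpha_lip: "L-lipschitz_on {0<..} \<alpha>"
    and D: "\<And>t. t > 0 \<Longrightarrow> t \<le> D * \<alpha> t"
    and T: "alpha_hom \<alpha> a b T"
    and f: "f \<in> Lip0 a" "\<And>x. 0 \<le> f x"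
  shows "0 \<le> T f y"
proof (cases "y = b")
  case True
  have "T f \<in> Lip0 b" using T f(1) Lip0_linear_in by (auto simp: alpha_hom_def)
  then show ?thesis using True by (simp add: Lip0_base)
next
  case y: False
  have ay: "\<alpha> (dist b y) > 0" using alpha_pos y by simp
  show ?thesis
  proof (rule ccontr)
    assume neg: "\<not> 0 \<le> T f y"
    define c where "c = T f y / \<alpha> (dist b y)"
    have Tf: "T f y = c * \<alpha> (dist b y)" using ay by (simp add: c_def)
    have c: "c < 0" using neg ay by (simp add: c_def divide_neg_pos)
    obtain x where x: "x \<noteq> a" and near: "\<bar>1 - f x / (c * \<alpha> (dist a x))\<bar> < 1"
      using character_value_not_separated[OF alpha_pos alpha_lip D T f(1) y _ Tf, of 1] c by auto
    have "f x / (c * \<alpha> (dist a x)) \<le> 0"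
      using f(2)[of x] c alpha_pos[of "dist a x"] x
      by (intro divide_nonneg_neg) (auto simp: mult_neg_pos)
    with near show False by linarith
  qed
qed

text \<open>
  Since \<open>D_const \<alpha>\<close> is positive and \<open>K_const \<alpha>\<close> is nonnegative, the bound on the product excludes
  \<open>D_const \<alpha> = \<infinity>\<close>.
\<close>

lemma D_const_finite:
  assumes alpha_pos: "\<And>t. t > 0 \<Longrightarrow> \<alpha> t > 0"
    and alpha_Lipschitz: "\<exists>L. L-lipschitz_on {0<..} \<alpha>"
    and alpha_small: "D_const \<alpha> * (K_const \<alpha> + 2) \<le> 1"
  obtains D where "\<And>t. t > 0 \<Longrightarrow> t \<le> D * \<alpha> t"
proof -
  have upper: "ereal (t / \<alpha> t) \<le> D_const \<alpha>" if "t > 0" for t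
    unfolding D_const_def using that by (intro SUP_upper) auto
  have "0 < ereal (1 / \<alpha> 1)" using alpha_pos[of 1] by simp
  also have "\<dots> \<le> D_const \<alpha>" by (rule upper) simp
  finally have pos: "0 < D_const \<alpha>" .
  have K0: "0 \<le> K_const \<alpha>"
    unfolding K_const_def using Lip_const_nonneg[OF alpha_Lipschitz] pos by simp
  then have "0 < K_const \<alpha> + 2" by (simp add: add_nonneg_pos)
  then have "D_const \<alpha> * (K_const \<alpha> + 2) = \<infinity>" if "D_const \<alpha> = \<infinity>"
    using that by (simp add: ereal_mult_eq_PInfty)
  then have "D_const \<alpha> \<noteq> \<infinity>" using alpha_small by auto
  then obtain D where D: "D_const \<alpha> = ereal D" using pos by (cases "D_const \<alpha>") auto
  have "t \<le> D * \<alpha> t" if "t > 0" for t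
    using upper[OF that] alpha_pos[OF that] by (simp add: D divide_le_eq)
  then show thesis by (rule that)
qed

section \<open>Algebra homomorphisms are bounded and preserve the order\<close>

theorem proposition5p9:
  fixes a :: "'a::metric_space" and b :: "'b::metric_space"
    and \<alpha> :: "real \<Rightarrow> real"
    and T :: "('a \<Rightarrow> real) \<Rightarrow> ('b \<Rightarrow> real)"
  assumes alpha_pos: "\<And>t. t > 0 \<Longrightarrow> \<alpha> t > 0"
    and alpha_Lipschitz: "\<exists>L. L-lipschitz_on {0<..} \<alpha>"
    and alpha_small: "D_const \<alpha> * (K_const \<alpha> + 2) \<le> 1"
    and T_hom: "alpha_hom \<alpha> a b T"
  shows "Lip0_bounded a T \<and> mono_on (Lip0 a) T"
proof
  have lin: "Lip0_linear a b T" using T_hom by (simp add: alpha_hom_def)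
  obtain L where L: "L-lipschitz_on {0<..} \<alpha>" using alpha_Lipschitz by blast
  obtain D where D: "\<And>t. t > 0 \<Longrightarrow> t \<le> D * \<alpha> t"
    using D_const_finite[OF alpha_pos alpha_Lipschitz alpha_small] by blast
  show "Lip0_bounded a T"
  proof (rule bounded_if_evaluations_bounded[OF lin])
    fix y
    show "\<exists>A. \<forall>f\<in>Lip0 a. \<forall>M. M-lipschitz_on UNIV f \<longrightarrow> \<bar>T f y\<bar> \<le> A * M"
    proof (cases "y = b")
      case True
      have "T f b = 0" if "f \<in> Lip0 a" for f
        using Lip0_base[OF Lip0_linear_in[OF lin that]] .
      then show ?thesis using True by (intro exI[of _ 0]) simp
    next
      case False
      then show ?thesis
        using alpha_hom_eval_bound[OF alpha_pos L D T_hom] by blast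
    qed
  qed
  show "mono_on (Lip0 a) T"
  proof (rule mono_onI, rule le_funI)
    fix f g y assume f: "f \<in> Lip0 a" and g: "g \<in> Lip0 a" and le: "f \<le> g"
    have "0 \<le> T (\<lambda>x. g x - f x) y"
      using le by (intro alpha_hom_nonneg[OF alpha_pos L D T_hom Lip0_diff[OF g f]])
        (auto simp: le_fun_def)
    then show "T f y \<le> T g y" by (simp add: Lip0_linear_diff[OF lin g f])
  qed
qed

end
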